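(* Let $X_1,X_2,\dots$ be any sequence of (possibly correlated) random variables with $\mathrm{Var}(X_i)<+\infty$ for $i=1,2,\dots$, and let $s\ge 1$. If $$\Big[\frac1n\sum_{i=1}^n(\mathrm{Var}(X_i))^s\Big]^{1/s}\to 0\quad(n\to+\infty),$$ then for any $\varepsilon>0$, $$\lim_{n\to\infty}P\Big(\Big|\frac1n\sum_{i=1}^nX_i-\frac1n\sum_{i=1}^nE X_i\Big|<\varepsilon\Big)=1.$$
   Context: Random variables are real-valued, defined on a common probability space with probability $P$, with finite expectation and variance. "Correlated" only means that no independence or uncorrelatedness is assumed. $E$ and $\mathrm{Var}$ denote expectation and variance. *)

theory Defs
  imports "HOL-Probability.Probability"
begin

end

theory Submission
  imports Defs
begin

text \<open>
  Since \<open>(\<Sum>i\<in>I. f i)\<^sup>2 \<le> card I * (\<Sum>i\<in>I. (f i)\<^sup>2)\<close> pointwise, the variance of the average of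
  \<open>X\<^sub>1, \<dots>, X\<^sub>n\<close> is at most the average of the variances, whatever the correlations. The power mean
  inequality bounds that average by the quantity assumed to tend to 0, and Chebyshev's inequality
  concludes.
\<close>

text \<open>Normalise by the power mean \<open>A\<close>: weighted AM-GM (Young) with weights 1/s
  and 1 - 1/s, applied to the s-th power of \<open>f i / A\<close> and to 1, bounds each
  \<open>f i / A\<close> linearly in that power. The normalised powers sum to \<open>card I\<close>,
  so summing over \<open>I\<close> gives the claim.\<close>

lemma mean_le_power_mean:
  fixes f :: "'b \<Rightarrow> real"
  assumes "finite I" and nonneg: "\<And>i. i \<in> I \<Longrightarrow> f i \<ge> 0" and s: "s \<ge> 1"
  shows "(1 / card I) * (\<Sum>i\<in>I. f i) \<le> ((1 / card I) * (\<Sum>i\<in>I. f i powr s)) powr (1 / s)"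
\<comment> \<open>The normalisation divides by \<open>A\<close>, so the case where \<open>A\<close>
  would vanish is split off; it also covers empty \<open>I\<close>.\<close>
proof (cases "\<forall>i\<in>I. f i = 0")
  case True
  then show ?thesis by simp
next
  case False
  then obtain j where j: "j \<in> I" "f j > 0"
    using nonneg by fastforce
  define n where "n = real (card I)"
  have n: "n > 0"
    unfolding n_def using j \<open>finite I\<close> by (auto simp: card_gt_0_iff)
  define T where "T = (\<Sum>i\<in>I. f i powr s)"
  have "0 < f j powr s"
    using j by simp
  also have "\<dots> \<le> T"
    unfolding T_def using j \<open>finite I\<close> by (intro member_le_sum) auto
  finally have T: "T > 0" .
  define A where "A = ((1 / n) * T) powr (1 / s)"
  have A: "A > 0"
    unfolding A_def using n T by simp
  have As: "A powr s = T / n"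
    unfolding A_def using n T s by (simp add: powr_powr)
  have bound: "f i \<le> A * ((1 / s) * (f i powr s / A powr s) + (1 - 1 / s))" if "i \<in> I" for i
  \<comment> \<open>Young's inequality is used for positive arguments only; at
    \<open>f i = 0\<close> the bound reduces to 0 \<le> A * (1 - 1/s), which holds as s \<ge>
    1.\<close>
  proof (cases "f i = 0")
    case True
    then show ?thesis using A s by simp
  next
    case False
    with nonneg[OF that] have fi: "f i > 0" by simp
    have "f i / A = (f i powr s / A powr s) powr (1 / s) * 1 powr (1 - 1 / s)"
      using fi A s by (simp add: powr_divide[symmetric] powr_powr)
    also have "\<dots> \<le> (1 / s) * (f i powr s / A powr s) + (1 - 1 / s) * 1"
      using fi A s by (intro Youngs_inequality_0) auto
    finally show ?thesis
      using A by (simp add: pos_divide_le_eq mult.commute)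
  qed
  have "(\<Sum>i\<in>I. f i) \<le> (\<Sum>i\<in>I. A * ((1 / s) * (f i powr s / A powr s) + (1 - 1 / s)))"
    by (intro sum_mono bound)
  also have "\<dots> = A * ((1 / s) * (T / A powr s) + n * (1 - 1 / s))"
    unfolding T_def n_def
    by (simp only: sum_distrib_left[symmetric] sum_divide_distrib[symmetric] sum.distrib sum_constant)
  \<comment> \<open>The choice of \<open>A\<close> makes \<open>T / A powr s\<close> equal to
    \<open>n\<close>, so the two weights recombine to n/s + n * (1 - 1/s) = n.\<close>
  also have "\<dots> = A * n"
    unfolding As using n T by (simp add: right_diff_distrib)
  finally show ?thesis
    using n unfolding A_def T_def n_def[symmetric] by (simp add: field_simps)
qed

text \<open>Cauchy-Schwarz dominates the square pointwise by an integrable function, so the cross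
  products \<open>Z i * Z j\<close> never have to be treated.\<close>

lemma integrable_sum_squared:
  fixes Z :: "'b \<Rightarrow> 'a \<Rightarrow> real"
  assumes [measurable]: "\<And>i. i \<in> I \<Longrightarrow> Z i \<in> borel_measurable M"
    and "\<And>i. i \<in> I \<Longrightarrow> integrable M (\<lambda>\<omega>. (Z i \<omega>)\<^sup>2)"
  shows "integrable M (\<lambda>\<omega>. (\<Sum>i\<in>I. Z i \<omega>)\<^sup>2)"
proof (rule Bochner_Integration.integrable_bound)
  show "integrable M (\<lambda>\<omega>. (\<Sum>i\<in>I. (Z i \<omega>)\<^sup>2) * real (card I))"
    using assms by simp
  show "AE \<omega> in M. norm ((\<Sum>i\<in>I. Z i \<omega>)\<^sup>2) \<le> norm ((\<Sum>i\<in>I. (Z i \<omega>)\<^sup>2) * real (card I))"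
    using sum_squared_le_sum_of_squares by (force simp: sum_nonneg)
qed measurable

text \<open>Markov's inequality for the squared sum, followed by Cauchy-Schwarz under the integral.
  The factor \<open>card I\<close> is the price for making no assumption on the
  correlations.\<close>

lemma (in finite_measure) measure_sum_ge_le:
  fixes Z :: "'b \<Rightarrow> 'a \<Rightarrow> real"
  assumes [measurable]: "\<And>i. i \<in> I \<Longrightarrow> Z i \<in> borel_measurable M"
    and sq: "\<And>i. i \<in> I \<Longrightarrow> integrable M (\<lambda>\<omega>. (Z i \<omega>)\<^sup>2)"
    and "a > 0"
  shows "measure M {\<omega> \<in> space M. \<bar>\<Sum>i\<in>I. Z i \<omega>\<bar> \<ge> a}
           \<le> card I * (\<Sum>i\<in>I. \<integral>\<omega>. (Z i \<omega>)\<^sup>2 \<partial>M) / a\<^sup>2"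
proof -
  have "measure M {\<omega> \<in> space M. \<bar>\<Sum>i\<in>I. Z i \<omega>\<bar> \<ge> a} \<le> (\<integral>\<omega>. (\<Sum>i\<in>I. Z i \<omega>)\<^sup>2 \<partial>M) / a\<^sup>2"
    using assms by (intro second_moment_method integrable_sum_squared) auto
  also have "(\<integral>\<omega>. (\<Sum>i\<in>I. Z i \<omega>)\<^sup>2 \<partial>M) \<le> (\<integral>\<omega>. (\<Sum>i\<in>I. (Z i \<omega>)\<^sup>2) * card I \<partial>M)"
    using assms by (intro integral_mono integrable_sum_squared sum_squared_le_sum_of_squares) auto
  also have "\<dots> = card I * (\<Sum>i\<in>I. \<integral>\<omega>. (Z i \<omega>)\<^sup>2 \<partial>M)"
    using sq by simp
  finally show ?thesis
    by (simp add: divide_right_mono)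
qed

theorem theorem8:
  fixes M :: "'a measure" and X :: "nat \<Rightarrow> 'a \<Rightarrow> real" and s :: real
  assumes prob: "prob_space M"
    and rv: "\<And>i. i \<ge> 1 \<Longrightarrow> X i \<in> borel_measurable M"
    and finite_expectation: "\<And>i. i \<ge> 1 \<Longrightarrow> integrable M (X i)"
    and finite_variance:
      "\<And>i. i \<ge> 1 \<Longrightarrow> integrable M (\<lambda>\<omega>. (X i \<omega> - prob_space.expectation M (X i))\<^sup>2)"
    and s: "s \<ge> 1"
    and lim: "(\<lambda>n. ((1 / real n) * (\<Sum>i=1..n. (prob_space.variance M (X i)) powr s)) powr (1 / s))
                \<longlonglongrightarrow> 0"
  shows "\<forall>\<epsilon>>0. (\<lambda>n. \<P>(\<omega> in M.
           \<bar>(1 / real n) * (\<Sum>i=1..n. X i \<omega>)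
             - (1 / real n) * (\<Sum>i=1..n. prob_space.expectation M (X i))\<bar> < \<epsilon>))
         \<longlonglongrightarrow> 1"
proof (intro allI impI)
  interpret prob_space M by (rule prob)
  fix \<epsilon> :: real
  assume \<epsilon>: "\<epsilon> > 0"
  define Z where "Z = (\<lambda>i \<omega>. X i \<omega> - expectation (X i))"
  define B where "B = (\<lambda>n. ((1 / real n) * (\<Sum>i=1..n. variance (X i) powr s)) powr (1 / s))"
  let ?dev = "\<lambda>n \<omega>. \<bar>(1 / real n) * (\<Sum>i=1..n. X i \<omega>) - (1 / real n) * (\<Sum>i=1..n. expectation (X i))\<bar>"
  have meas: "Z i \<in> borel_measurable M" if "i \<in> {1..n}" for i n
    unfolding Z_def using rv that by simp
  have [measurable]: "(\<lambda>\<omega>. \<Sum>i=1..n. X i \<omega>) \<in> borel_measurable M" for n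
    using rv by (intro borel_measurable_sum) simp
  have sq: "integrable M (\<lambda>\<omega>. (Z i \<omega>)\<^sup>2)" if "i \<in> {1..n}" for i n
    unfolding Z_def using finite_variance that by simp
  have lower: "1 - B n / \<epsilon>\<^sup>2 \<le> \<P>(\<omega> in M. ?dev n \<omega> < \<epsilon>)" if n: "n > 0" for n
  proof -
    \<comment> \<open>Multiplying by \<open>n\<close> needs n > 0: at n = 0 the left side is true
      and the right side false.\<close>
    have "?dev n \<omega> < \<epsilon> \<longleftrightarrow> \<not> \<bar>\<Sum>i=1..n. Z i \<omega>\<bar> \<ge> real n * \<epsilon>" for \<omega>
      using n unfolding Z_def
      by (simp add: sum_subtractf diff_divide_distrib[symmetric] abs_divide
          pos_divide_less_eq mult.commute not_le)
    then have "\<P>(\<omega> in M. ?dev n \<omega> < \<epsilon>) = \<P>(\<omega> in M. \<not> \<bar>\<Sum>i=1..n. Z i \<omega>\<bar> \<ge> real n * \<epsilon>)"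
      by simp
    also have "\<dots> = 1 - \<P>(\<omega> in M. \<bar>\<Sum>i=1..n. Z i \<omega>\<bar> \<ge> real n * \<epsilon>)"
      using meas by (intro prob_neg) measurable
    finally have eq: "\<P>(\<omega> in M. ?dev n \<omega> < \<epsilon>) = \<dots>" .
    have "\<P>(\<omega> in M. \<bar>\<Sum>i=1..n. Z i \<omega>\<bar> \<ge> real n * \<epsilon>)
            \<le> card {1..n} * (\<Sum>i=1..n. \<integral>\<omega>. (Z i \<omega>)\<^sup>2 \<partial>M) / (real n * \<epsilon>)\<^sup>2"
      using n \<epsilon> by (intro measure_sum_ge_le meas sq) auto
    \<comment> \<open>The second moment of the centred \<open>Z i\<close> is the variance of
      \<open>X i\<close>. The factor \<open>n\<close> from Cauchy-Schwarz meets the square of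
      \<open>n\<close> from the threshold, which leaves exactly the mean of the variances.\<close>
    also have "\<dots> = (1 / card {1..n}) * (\<Sum>i=1..n. variance (X i)) / \<epsilon>\<^sup>2"
      using n by (simp add: Z_def power2_eq_square)
    also have "\<dots> \<le> B n / \<epsilon>\<^sup>2"
      using mean_le_power_mean[of "{1..n}" "\<lambda>i. variance (X i)" s] s
      by (intro divide_right_mono) (simp_all add: B_def)
    finally show ?thesis
      unfolding eq by simp
  qed
  have "(\<lambda>n. 1 - B n / \<epsilon>\<^sup>2) \<longlonglongrightarrow> 1 - 0 / \<epsilon>\<^sup>2"
    using lim \<epsilon> unfolding B_def by (intro tendsto_intros) auto
  then have B_lim: "(\<lambda>n. 1 - B n / \<epsilon>\<^sup>2) \<longlonglongrightarrow> 1"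
    by simp
  show "(\<lambda>n. \<P>(\<omega> in M. ?dev n \<omega> < \<epsilon>)) \<longlonglongrightarrow> 1"
  \<comment> \<open>The upper bound is the constant 1, since these are probabilities.\<close>
  proof (rule tendsto_sandwich[OF _ _ B_lim tendsto_const])
    show "\<forall>\<^sub>F n in sequentially. 1 - B n / \<epsilon>\<^sup>2 \<le> \<P>(\<omega> in M. ?dev n \<omega> < \<epsilon>)"
      using eventually_gt_at_top[of 0] by eventually_elim (rule lower)
  qed simp
qed

end
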